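(* Let $N_\beta(\alpha)=\#\{(k,m)\in\mathbb{Z}_{>0}^2 : m\le \alpha\sqrt{\beta}-k\beta\}$ for $\alpha,\beta>0$. Then $$\liminf_{\alpha\to\infty}\ \sup_{\beta>0}\ \frac{N_\beta(\alpha)-\alpha^2/2}{\alpha}=-1.$$
   Context: $N_\beta(\alpha)$ counts lattice points with positive integer coordinates in the closed triangle with vertices $(0,0)$, $(\alpha/\sqrt\beta,0)$, $(0,\alpha\sqrt\beta)$, which has area $\alpha^2/2$. *)

theory Defs
  imports "HOL-Analysis.Analysis"
begin

definition lattice_count :: "real \<Rightarrow> real \<Rightarrow> nat" where
  "lattice_count \<beta> \<alpha> =
     card {(k :: int, m :: int).
       0 < k \<and> 0 < m \<and> real_of_int m \<le> \<alpha> * sqrt \<beta> - real_of_int k * \<beta>}"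

text \<open>The set counted is finite for positive \<open>\<alpha>\<close> and \<open>\<beta>\<close>, so \<^const>\<open>card\<close> is its true number of elements there.\<close>

lemma finite_lattice_points:
  assumes "\<alpha> > 0" "\<beta> > 0"
  shows "finite {(k :: int, m :: int).
           0 < k \<and> 0 < m \<and> real_of_int m \<le> \<alpha> * sqrt \<beta> - real_of_int k * \<beta>}"
proof (rule finite_subset)
  show "{(k :: int, m :: int).
           0 < k \<and> 0 < m \<and> real_of_int m \<le> \<alpha> * sqrt \<beta> - real_of_int k * \<beta>}
        \<subseteq> {0..\<lceil>\<alpha> * sqrt \<beta> / \<beta>\<rceil>} \<times> {0..\<lceil>\<alpha> * sqrt \<beta>\<rceil>}"
  proof clarify
    fix k m :: int
    assume k: "0 < k" and m: "0 < m"
      and le: "real_of_int m \<le> \<alpha> * sqrt \<beta> - real_of_int k * \<beta>"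
    have "real_of_int k * \<beta> \<le> \<alpha> * sqrt \<beta>" using le m by linarith
    then have "real_of_int k \<le> \<alpha> * sqrt \<beta> / \<beta>"
      using assms(2) by (simp add: pos_le_divide_eq)
    then have 1: "k \<le> \<lceil>\<alpha> * sqrt \<beta> / \<beta>\<rceil>" by linarith
    have "0 < real_of_int k * \<beta>" using k assms(2) by simp
    then have "m \<le> \<lceil>\<alpha> * sqrt \<beta>\<rceil>" using le by linarith
    then show "k \<in> {0..\<lceil>\<alpha> * sqrt \<beta> / \<beta>\<rceil>} \<and> m \<in> {0..\<lceil>\<alpha> * sqrt \<beta>\<rceil>}"
      using 1 k m by simp
  qed
qed simp

end

theory Submission
  imports Defs
begin

text \<open>The lower bound comes from \<open>\<beta> = 1 + 1 / q\<close>, for which \<open>N\<^sub>\<beta>(\<alpha>) \<ge> \<alpha>\<^sup>2 / 2 - \<alpha> \<surd>\<beta> - O(1)\<close>; let \<open>q \<rightarrow> \<infinity>\<close>.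

  For the upper bound choose, by Dirichlet's theorem, a large \<open>\<alpha>\<^sub>0\<close> such that \<open>\<alpha>\<^sub>0 \<surd>d\<close> is nearly an integer for all
  \<open>d \<le> D\<close>, and put \<open>\<alpha> = \<alpha>\<^sub>0 - \<delta>\<close>. Counting by columns, \<open>N\<^sub>\<beta>(\<alpha>)\<close> is a sum of floors, which up to \<open>O(\<delta> \<alpha>)\<close> may be
  replaced by \<open>x - 1 / 2 + S(x)\<close> at \<open>x = \<alpha>\<^sub>0 \<surd>\<beta> - k \<beta>\<close> for a fixed sine polynomial \<open>S\<close>: passing from \<open>\<alpha>\<^sub>0\<close> to \<open>\<alpha>\<close> absorbs the
  jumps of the floor function. The main terms give \<open>\<alpha>\<^sup>2 / 2 - \<alpha> (\<surd>\<beta> + 1 / \<surd>\<beta>) / 2 \<le> \<alpha>\<^sup>2 / 2 - \<alpha>\<close>. A sum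
  \<open>\<Sum>\<^sub>k sin (2 \<pi> h (\<alpha>\<^sub>0 \<surd>\<beta> - k \<beta>))\<close> is \<open>o(\<alpha>)\<close> uniformly in \<open>\<beta>\<close>: either \<open>h \<beta>\<close> is not within \<open>O(1 / \<alpha>)\<close> of an integer and the
  sum oscillates, or it is close to some \<open>l\<close> and the terms are symmetric about the phase \<open>\<alpha>\<^sub>0 \<surd>(h l)\<close>, where the
  sine nearly vanishes.\<close>

section \<open>Symmetry and column sums of the lattice count\<close>

text \<open>Reflecting the triangle in the diagonal exchanges its legs. This later carries slopes
  below 1/16 to slopes above 16.\<close>

lemma lattice_count_inverse: assumes "\<beta> > 0" shows "lattice_count (1/\<beta>) \<alpha> = lattice_count \<beta> \<alpha>"
proof -
  have key: "real_of_int m \<le> \<alpha> * sqrt (1/\<beta>) - real_of_int k * (1/\<beta>) \<longleftrightarrow>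
     real_of_int k \<le> \<alpha> * sqrt \<beta> - real_of_int m * \<beta>" for k m
  proof -
    define s where "s = sqrt \<beta>"
    have s: "s > 0" "\<beta> = s * s" using assms by (auto simp: s_def)
    have "sqrt (1/\<beta>) = 1/s" by (simp add: s_def real_sqrt_divide)
    then show ?thesis using s by (simp add: s_def[symmetric] field_simps)
  qed
  have "{(k :: int, m :: int). 0 < k \<and> 0 < m \<and> real_of_int m \<le> \<alpha> * sqrt (1/\<beta>) - real_of_int k * (1/\<beta>)}
     = prod.swap ` {(k :: int, m :: int). 0 < k \<and> 0 < m \<and> real_of_int m \<le> \<alpha> * sqrt \<beta> - real_of_int k * \<beta>}"
    unfolding key by force
  then show ?thesis unfolding lattice_count_def by (simp add: card_image)
qed

text \<open>The last index is that of the last column whose height is nonnegative, so no floor in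
  the sum is negative and each is the size of its column.\<close>

lemma lattice_count_eq_sum:
  assumes "\<alpha> > 0" "\<beta> > 0"
  shows "real (lattice_count \<beta> \<alpha>) =
    (\<Sum>k=1..nat \<lfloor>\<alpha> / sqrt \<beta>\<rfloor>. real_of_int \<lfloor>\<alpha> * sqrt \<beta> - real k * \<beta>\<rfloor>)"
proof -
  define K where "K = nat \<lfloor>\<alpha> / sqrt \<beta>\<rfloor>"
  define f where "f k = \<lfloor>\<alpha> * sqrt \<beta> - real k * \<beta>\<rfloor>" for k
  have K: "k \<le> K \<longleftrightarrow> real k * \<beta> \<le> \<alpha> * sqrt \<beta>" for k
  proof -
    define s where "s = sqrt \<beta>"
    have s: "s > 0" "\<beta> = s * s" using assms by (auto simp: s_def)
    have "k \<le> K \<longleftrightarrow> real k \<le> \<alpha> / s"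
      using assms s unfolding K_def s_def[symmetric] by (simp add: le_nat_floor le_nat_iff le_floor_iff)
    also have "\<dots> \<longleftrightarrow> real k * \<beta> \<le> \<alpha> * s" using s by (simp add: field_simps)
    finally show ?thesis by (simp add: s_def)
  qed
  have "{(k :: int, m :: int). 0 < k \<and> 0 < m \<and> real_of_int m \<le> \<alpha> * sqrt \<beta> - real_of_int k * \<beta>}
    = (\<lambda>(k, m). (int k, m)) ` (SIGMA k:{1..K}. {1..f k})" (is "?L = ?R")
  proof (intro set_eqI iffI)
    fix z assume "z \<in> ?L"
    then obtain k m where z: "z = (k, m)" "0 < k" "0 < m" "real_of_int m \<le> \<alpha> * sqrt \<beta> - real_of_int k * \<beta>" by auto
    define j where "j = nat k"
    have j: "k = int j" "j \<ge> 1" using z by (auto simp: j_def)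
    have "real j * \<beta> \<le> \<alpha> * sqrt \<beta>" using z j by simp
    then have "(j, m) \<in> (SIGMA k:{1..K}. {1..f k})" using z j by (simp add: K f_def le_floor_iff)
    then show "z \<in> ?R" using z j by force
  next
    fix z assume "z \<in> ?R"
    then show "z \<in> ?L" by (auto simp: f_def le_floor_iff)
  qed
  then have "lattice_count \<beta> \<alpha> = card (SIGMA k:{1..K}. {1..f k})"
    unfolding lattice_count_def by (simp add: card_image inj_on_def)
  also have "\<dots> = (\<Sum>k=1..K. nat (f k))" by (simp add: card_SigmaI)
  finally have "real (lattice_count \<beta> \<alpha>) = (\<Sum>k=1..K. real (nat (f k)))" by simp
  also have "\<dots> = (\<Sum>k=1..K. real_of_int (f k))"
  proof (rule sum.cong)
    fix k assume "k \<in> {1..K}"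
    then have "f k \<ge> 0" using K[of k] by (simp add: f_def)
    then show "real (nat (f k)) = real_of_int (f k)" by simp
  qed simp
  finally show ?thesis by (simp add: f_def K_def)
qed

section \<open>Sine sums along the columns\<close>

lemma sin_ge_half:
  fixes x :: real
  assumes "0 \<le> x" "x \<le> pi / 2"
  shows "x / 2 \<le> sin x"
proof -
  have "\<bar>sin x - (\<Sum>m<3. sin_coeff m * x ^ m)\<bar> \<le> inverse (fact 3) * \<bar>x\<bar> ^ 3"
    by (rule Maclaurin_sin_bound)
  moreover have "(\<Sum>m<3. sin_coeff m * x ^ m) = x"
    by (simp add: lessThan_nat_numeral lessThan_Suc sin_coeff_def)
  ultimately have "\<bar>sin x - x\<bar> \<le> x ^ 3 / 6"
    using assms(1) by (simp add: fact_numeral)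
  then have 1: "x - x ^ 3 / 6 \<le> sin x" by linarith
  \<comment> \<open>As pi/2 is at most 1.6 and 1.6 * 1.6 < 3, the cubic term takes away at most
    x/2.\<close>
  have "pi \<le> 3.2" using pi_approx(2) by simp
  then have "x \<le> 1.6" using assms(2) by simp
  then have "x * x \<le> 1.6 * 1.6" using assms by (intro mult_mono) auto
  then have "x * (x * x) \<le> x * 3" using assms by (intro mult_left_mono) auto
  then show ?thesis using 1 by (simp add: power3_eq_cube)
qed

lemma abs_sin_pi_ge:
  fixes \<theta> :: real
  assumes "\<bar>\<theta>\<bar> \<le> 1 / 2"
  shows "\<bar>\<theta>\<bar> \<le> \<bar>sin (pi * \<theta>)\<bar>"
proof -
  have "pi * \<bar>\<theta>\<bar> \<le> pi * (1/2)" using assms by (intro mult_left_mono) auto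
  then have "pi * \<bar>\<theta>\<bar> / 2 \<le> sin (pi * \<bar>\<theta>\<bar>)" by (intro sin_ge_half) auto
  moreover have "2 * \<bar>\<theta>\<bar> \<le> pi * \<bar>\<theta>\<bar>" using pi_ge_two by (intro mult_right_mono) auto
  moreover have "sin (pi * \<bar>\<theta>\<bar>) \<le> \<bar>sin (pi * \<theta>)\<bar>" by (cases "\<theta> \<ge> 0") auto
  ultimately show ?thesis by linarith
qed

text \<open>Multiplication by 2 sin(pi \<theta>) makes the sum telescope to a difference of two
  cosines.\<close>

lemma sum_sin_le_inverse:
  fixes \<theta> :: real
  assumes "\<theta> \<noteq> 0" "\<bar>\<theta>\<bar> \<le> 1 / 2"
  shows "\<bar>\<Sum>k=1..K. sin (A - 2 * pi * real k * \<theta>)\<bar> \<le> 1 / \<bar>\<theta>\<bar>"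
proof -
  define c where "c k = cos (A - 2 * pi * real k * \<theta> - pi * \<theta>)" for k :: nat
  have tel: "2 * sin (pi * \<theta>) * sin (A - 2 * pi * real (Suc k) * \<theta>) = c (Suc k) - c k" for k
  proof -
    have *: "2 * sin y * sin x = cos (x - y) - cos (x + y)" for x y :: real
      by (simp add: cos_add cos_diff)
    have e1: "A - 2 * pi * real (Suc k) * \<theta> + pi * \<theta> = A - 2 * pi * real k * \<theta> - pi * \<theta>"
      by (simp add: algebra_simps)
    show ?thesis
      using *[of "pi * \<theta>" "A - 2 * pi * real (Suc k) * \<theta>"] unfolding c_def e1 .
  qed
  define S where "S = (\<Sum>k=1..K. sin (A - 2 * pi * real k * \<theta>))"
  have "2 * sin (pi * \<theta>) * S = c K - c 0"
    unfolding S_def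
    by (induction K) (simp_all add: distrib_left tel del: of_nat_Suc)
  moreover have "\<bar>c K - c 0\<bar> \<le> 2"
    using abs_cos_le_one[of "A - 2 * pi * real K * \<theta> - pi * \<theta>"]
      abs_cos_le_one[of "A - 2 * pi * real 0 * \<theta> - pi * \<theta>"]
    unfolding c_def by linarith
  ultimately have "\<bar>sin (pi * \<theta>)\<bar> * \<bar>S\<bar> \<le> 1"
    by (simp flip: abs_mult add: mult.assoc)
  moreover have "\<bar>\<theta>\<bar> * \<bar>S\<bar> \<le> \<bar>sin (pi * \<theta>)\<bar> * \<bar>S\<bar>"
    using abs_sin_pi_ge[OF assms(2)] by (intro mult_right_mono) auto
  ultimately show ?thesis
    using assms(1) unfolding S_def[symmetric] by (simp add: field_simps)
qed

text \<open>Pairing k with K + 1 - k leaves the sine of the mean phase as a common factor. This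
  serves when \<theta> is zero or too small for the oscillation bound.\<close>

lemma sum_sin_le_centre:
  fixes \<theta> :: real
  shows "\<bar>\<Sum>k=1..K. sin (A - 2 * pi * real k * \<theta>)\<bar> \<le> real K * \<bar>sin (A - pi * (real K + 1) * \<theta>)\<bar>"
proof -
  define f where "f k = sin (A - 2 * pi * real k * \<theta>)" for k :: nat
  define M where "M = A - pi * (real K + 1) * \<theta>"
  have pair: "\<bar>f k + f (K + 1 - k)\<bar> \<le> 2 * \<bar>sin M\<bar>" if "k \<in> {1..K}" for k
  proof -
    define t where "t = pi * (real K + 1) * \<theta> - 2 * pi * real k * \<theta>"
    have "f k = sin (M + t)" by (simp add: f_def M_def t_def)
    moreover have "f (K + 1 - k) = sin (M - t)"
      using that by (simp add: f_def M_def t_def algebra_simps of_nat_diff)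
    ultimately have "f k + f (K + 1 - k) = 2 * sin M * cos t" by (simp add: sin_add sin_diff)
    then have "\<bar>f k + f (K + 1 - k)\<bar> = 2 * \<bar>sin M\<bar> * \<bar>cos t\<bar>" by (simp add: abs_mult)
    also have "\<dots> \<le> 2 * \<bar>sin M\<bar> * 1" by (intro mult_left_mono) auto
    finally show ?thesis by simp
  qed
  have "(\<Sum>k=1..K. f k) = (\<Sum>k=1..K. f (K + 1 - k))"
    by (rule sum.atLeastAtMost_rev[THEN trans]) simp
  then have "2 * (\<Sum>k=1..K. f k) = (\<Sum>k=1..K. f k + f (K + 1 - k))" by (simp add: sum.distrib)
  then have "2 * \<bar>\<Sum>k=1..K. f k\<bar> = \<bar>\<Sum>k=1..K. f k + f (K + 1 - k)\<bar>" by (simp flip: abs_mult)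
  also have "\<dots> \<le> (\<Sum>k=1..K. \<bar>f k + f (K + 1 - k)\<bar>)" by (rule sum_abs)
  also have "\<dots> \<le> of_nat (card {1..K}) * (2 * \<bar>sin M\<bar>)" using pair by (rule sum_bounded_above)
  finally show ?thesis by (simp add: f_def M_def)
qed

lemma sin_2pi_shift:
  fixes x :: real and n :: int
  shows "sin (2 * pi * (x - of_int n)) = sin (2 * pi * x)"
proof -
  have "sin (2 * pi * (x - of_int n)) = sin (2 * pi * x - 2 * pi * of_int n)"
    by (simp add: right_diff_distrib)
  also have "\<dots> = sin (2 * pi * x)"
    using sin_integer_2pi[of "of_int n :: real"] cos_integer_2pi[of "of_int n :: real"]
    unfolding sin_diff by simp
  finally show ?thesis .
qed

lemma abs_sin_2pi_le:
  fixes x :: real and n :: int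
  shows "\<bar>sin (2 * pi * x)\<bar> \<le> 2 * pi * \<bar>x - of_int n\<bar>"
  using abs_sin_x_le_abs_x[of "2 * pi * (x - of_int n)"] unfolding sin_2pi_shift by (simp add: abs_mult)

text \<open>Write \<open>h \<beta> = l + \<theta>\<close> with \<open>l\<close> the nearest integer. A large \<open>\<theta>\<close> makes the sum oscillate; for small
  \<open>\<theta>\<close> the terms are symmetric about a phase which is \<open>\<alpha> (h \<surd>\<beta> + l / \<surd>\<beta>) / 2\<close> up to \<open>O(\<theta>)\<close>, and this is
  \<open>\<alpha> \<surd>(h l)\<close> up to \<open>O(\<alpha> \<theta>\<^sup>2)\<close>.\<close>

lemma sum_sin_lattice_le:
  fixes \<alpha> \<beta> \<epsilon> :: real and h K :: nat
  assumes \<epsilon>: "0 < \<epsilon>" and h: "1 \<le> h" and \<beta>: "1 / 16 \<le> \<beta>" "\<beta> \<le> 16"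
    and \<alpha>: "2 \<le> \<alpha>" "100 * (3 / (2 * \<epsilon>) + 32 / \<epsilon>\<^sup>2) / \<epsilon> \<le> \<alpha>"
    and K: "\<bar>real K - \<alpha> / sqrt \<beta>\<bar> \<le> 2"
    and int: "\<And>l. l \<le> 16 * h + 1 \<Longrightarrow> \<exists>n::int. \<bar>\<alpha> * sqrt (real (h * l)) - of_int n\<bar> \<le> \<epsilon> / 100"
  shows "\<bar>\<Sum>k=1..K. sin (2 * pi * real h * (\<alpha> * sqrt \<beta> - real k * \<beta>))\<bar> \<le> \<epsilon> * \<alpha>"
proof -
  define s where "s = sqrt \<beta>"
  have s: "s > 0" "\<beta> = s * s" using \<beta> by (auto simp: s_def)
  have s4: "1 / 4 \<le> s"
    unfolding s_def using \<beta> by (intro real_le_rsqrt) (simp add: power2_eq_square)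
  define l where "l = nat (round (real h * \<beta>))"
  define \<theta> where "\<theta> = real h * \<beta> - real l"
  have "0 \<le> real h * \<beta>" using \<beta> by simp
  then have "round (real h * \<beta>) \<ge> 0" by (simp add: round_def)
  then have l: "real l = of_int (round (real h * \<beta>))" by (simp add: l_def)
  have \<theta>: "\<bar>\<theta>\<bar> \<le> 1 / 2"
    using of_int_round_abs_le[of "real h * \<beta>"] by (simp add: \<theta>_def l abs_minus_commute)
  have "real h * \<beta> \<le> real h * 16" using \<beta> by (intro mult_left_mono) auto
  then have "real l \<le> real (16 * h + 1)" using \<theta> unfolding \<theta>_def of_nat_add of_nat_mult of_nat_numeral of_nat_1 by linarith
  then have l16: "l \<le> 16 * h + 1" by (simp only: of_nat_le_iff)
  have eq: "(\<Sum>k=1..K. sin (2 * pi * real h * (\<alpha> * sqrt \<beta> - real k * \<beta>)))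
     = (\<Sum>k=1..K. sin (2 * pi * real h * \<alpha> * s - 2 * pi * real k * \<theta>))"
  proof (rule sum.cong)
    fix k
    have "sin (2 * pi * real h * (\<alpha> * sqrt \<beta> - real k * \<beta>)) = sin (2 * pi * (real h * (\<alpha> * s - real k * \<beta>)))"
      by (simp add: s_def mult.assoc)
    \<comment> \<open>Since k l is an integer, h \<beta> may be replaced by \<theta> in the step of
      the phase.\<close>
    also have "\<dots> = sin (2 * pi * (real h * (\<alpha> * s - real k * \<beta>) - of_int (- int (k * l))))"
      by (rule sin_2pi_shift[symmetric])
    also have "2 * pi * (real h * (\<alpha> * s - real k * \<beta>) - of_int (- int (k * l)))
       = 2 * pi * real h * \<alpha> * s - 2 * pi * real k * \<theta>"
      by (simp add: \<theta>_def algebra_simps)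
    finally show "sin (2 * pi * real h * (\<alpha> * sqrt \<beta> - real k * \<beta>))
      = sin (2 * pi * real h * \<alpha> * s - 2 * pi * real k * \<theta>)" .
  qed simp
  show ?thesis
  \<comment> \<open>The threshold is where the oscillation bound 1/|\<theta>| reaches \<epsilon>
    \<alpha>.\<close>
  proof (cases "1 / (\<epsilon> * \<alpha>) \<le> \<bar>\<theta>\<bar>")
    case True
    have pos: "0 < \<epsilon> * \<alpha>" using \<epsilon> \<alpha> by simp
    then have nz: "\<theta> \<noteq> 0" using True by (auto simp: divide_le_0_iff)
    have "1 \<le> \<bar>\<theta>\<bar> * (\<epsilon> * \<alpha>)" using True by (subst (asm) pos_divide_le_eq[OF pos])
    then have "1 / \<bar>\<theta>\<bar> \<le> \<epsilon> * \<alpha>" using nz by (subst pos_divide_le_eq) (auto simp: mult.commute)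
    then show ?thesis
      unfolding eq using sum_sin_le_inverse[OF nz \<theta>, where K = K and A = "2 * pi * real h * \<alpha> * s"] by linarith
  next
    case False
    define T where "T = 1 / \<epsilon>"
    have T: "\<bar>\<theta>\<bar> \<le> T / \<alpha>" using False \<alpha> \<epsilon> by (simp add: T_def)
    have T0: "T > 0" using \<epsilon> by (simp add: T_def)
    \<comment> \<open>2 pi x is the mean phase of the K terms.\<close>
    define x where "x = real h * \<alpha> * s - (real K + 1) * \<theta> / 2"
    have hl: "sqrt (real (h * l)) = sqrt (real h) * sqrt (real l)" by (simp add: real_sqrt_mult)
    define d where "d = sqrt (real h) * s - sqrt (real l)"
    \<comment> \<open>Factor \<theta> as a difference of squares; the cofactor of d is at least 1/4
      because h \<ge> 1 and s \<ge> 1/4.\<close>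
    have d2: "d\<^sup>2 \<le> \<theta>\<^sup>2 * 16"
    proof -
      have "d * (sqrt (real h) * s + sqrt (real l)) = \<theta>"
        by (simp add: d_def \<theta>_def s(2) algebra_simps)
      moreover have "\<bar>sqrt (real h) * s + sqrt (real l)\<bar> = sqrt (real h) * s + sqrt (real l)"
        using s(1) by (intro abs_of_nonneg) auto
      ultimately have "\<bar>\<theta>\<bar> = \<bar>d\<bar> * (sqrt (real h) * s + sqrt (real l))" by (metis abs_mult)
      moreover have "1 * (1/4) + 0 \<le> sqrt (real h) * s + sqrt (real l)"
        using h s4 by (intro add_mono mult_mono) auto
      ultimately have "\<bar>d\<bar> * (1/4) \<le> \<bar>\<theta>\<bar>" by (metis abs_ge_zero add.right_neutral mult_1 mult_left_mono)
      then have "\<bar>d\<bar>\<^sup>2 \<le> (4 * \<bar>\<theta>\<bar>)\<^sup>2" by (intro power_mono) auto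
      then show ?thesis by (simp add: power_mult_distrib)
    qed
    \<comment> \<open>By d^2 + \<theta> = 2 s \<open>sqrt h\<close> d, the part of x linear in
      \<theta> cancels up to the bounded factor K + 1 - \<alpha>/s, leaving a quadratic
      error.\<close>
    have xe: "x - \<alpha> * sqrt (real (h * l)) = \<alpha> * d\<^sup>2 / (2 * s) - (real K + 1 - \<alpha> / s) * \<theta> / 2"
    proof -
      have "\<theta> = sqrt (real h) * sqrt (real h) * (s * s) - sqrt (real l) * sqrt (real l)"
        by (simp add: \<theta>_def s(2))
      then have "d\<^sup>2 + \<theta> = 2 * s * (sqrt (real h) * d)"
        by (simp add: d_def power2_eq_square algebra_simps)
      moreover have "\<alpha> * d\<^sup>2 / (2 * s) + \<alpha> / s * \<theta> / 2 = \<alpha> / (2 * s) * (d\<^sup>2 + \<theta>)"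
        by (simp add: distrib_left)
      ultimately have "\<alpha> * d\<^sup>2 / (2 * s) + \<alpha> / s * \<theta> / 2 = \<alpha> * (sqrt (real h) * d)"
        using s(1) by simp
      moreover have "\<alpha> * (sqrt (real h) * d) = real h * \<alpha> * s - \<alpha> * sqrt (real (h * l))"
        unfolding hl d_def by (simp add: algebra_simps)
      ultimately show ?thesis unfolding x_def by (simp add: left_diff_distrib diff_divide_distrib)
    qed
    have "\<bar>x - \<alpha> * sqrt (real (h * l))\<bar> \<le> \<alpha> * (T / \<alpha>)\<^sup>2 * 32 + 3 * (T / \<alpha>) / 2"
    proof -
      have th2: "\<theta>\<^sup>2 \<le> (T / \<alpha>)\<^sup>2" using power_mono[OF T, of 2] by simp
      have "\<alpha> * d\<^sup>2 / (2 * s) \<le> \<alpha> * ((T / \<alpha>)\<^sup>2 * 16) / (2 * (1 / 4))"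
        using d2 th2 \<alpha> s4 by (intro frac_le mult_left_mono) auto
      also have "\<dots> = \<alpha> * (T / \<alpha>)\<^sup>2 * 32" by simp
      finally have 1: "\<alpha> * d\<^sup>2 / (2 * s) \<le> \<alpha> * (T / \<alpha>)\<^sup>2 * 32" .
      have 2: "0 \<le> \<alpha> * d\<^sup>2 / (2 * s)" using \<alpha> s by simp
      have 3: "\<bar>(real K + 1 - \<alpha> / s) * \<theta>\<bar> \<le> 3 * (T / \<alpha>)"
        unfolding abs_mult using T K by (intro mult_mono) (auto simp: s_def)
      have "\<bar>p - q / 2\<bar> \<le> P + Q / 2" if "p \<le> P" "0 \<le> p" "\<bar>q\<bar> \<le> Q" for p q P Q :: real
        using that by linarith
      from this[OF 1 2 3] show ?thesis unfolding xe .
    qed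
    also have "\<dots> = (3 / (2 * \<epsilon>) + 32 / \<epsilon>\<^sup>2) / \<alpha>"
      using \<alpha>(1) by (simp add: T_def power2_eq_square add_divide_distrib)
    also have "\<dots> \<le> \<epsilon> / 100"
    proof -
      have "100 * (3 / (2 * \<epsilon>) + 32 / \<epsilon>\<^sup>2) \<le> \<alpha> * \<epsilon>" using \<alpha>(2) \<epsilon> by (subst (asm) pos_divide_le_eq)
      then show ?thesis using \<alpha>(1) by (subst pos_divide_le_eq) (auto simp: mult.commute)
    qed
    finally have x1: "\<bar>x - \<alpha> * sqrt (real (h * l))\<bar> \<le> \<epsilon> / 100" .
    obtain n :: int where "\<bar>\<alpha> * sqrt (real (h * l)) - of_int n\<bar> \<le> \<epsilon> / 100" using int[OF l16] by blast
    with x1 have "\<bar>x - of_int n\<bar> \<le> \<epsilon> / 50" by linarith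
    then have "2 * pi * \<bar>x - of_int n\<bar> \<le> 2 * pi * (\<epsilon> / 50)" by (intro mult_left_mono) auto
    also have "\<dots> \<le> 2 * 4 * (\<epsilon> / 50)" using pi_less_4 \<epsilon> by (intro mult_right_mono) auto
    finally have "\<bar>sin (2 * pi * x)\<bar> \<le> 8 * \<epsilon> / 50" using abs_sin_2pi_le[of x n] by simp
    moreover have "real K \<le> 5 * \<alpha>"
    proof -
      have "\<alpha> / s \<le> \<alpha> / (1/4)" using \<alpha> s4 by (intro divide_left_mono) auto
      then show ?thesis using K \<alpha> unfolding s_def[symmetric] by simp
    qed
    \<comment> \<open>Two errors \<epsilon>/100, the bound 2 pi \<le> 8 and K \<le> 5 \<alpha> give
      4/5 of the allowed \<epsilon> \<alpha>.\<close>
    ultimately have "real K * \<bar>sin (2 * pi * x)\<bar> \<le> 5 * \<alpha> * (8 * \<epsilon> / 50)"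
      by (intro mult_mono) auto
    also have "\<dots> \<le> \<epsilon> * \<alpha>" using \<alpha> \<epsilon> by simp
    finally have "real K * \<bar>sin (2 * pi * x)\<bar> \<le> \<epsilon> * \<alpha>" .
    moreover have "2 * pi * x = 2 * pi * real h * \<alpha> * s - pi * (real K + 1) * \<theta>"
      by (simp add: x_def algebra_simps)
    ultimately show ?thesis
      unfolding eq using sum_sin_le_centre[where K = K and A = "2 * pi * real h * \<alpha> * s" and \<theta> = \<theta>] by simp
  qed
qed

section \<open>A sine polynomial bounding the floor function\<close>

text \<open>By the half-angle formulas, 1 - cis \<theta> is the positive number 2 sin(\<theta>/2)
  times a point of the unit circle at angle (\<theta> - pi)/2, which lies in the principal range. So
  the logarithm produces the sawtooth.\<close>

lemma Im_Ln_one_minus_cis: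
  assumes "0 < \<theta>" "\<theta> < 2 * pi"
  shows "Im (Ln (1 - cis \<theta>)) = (\<theta> - pi) / 2"
proof -
  have pos: "sin (\<theta> / 2) > 0" using assms by (intro sin_gt_zero) auto
  have "1 - cis \<theta> = of_real (2 * sin (\<theta> / 2)) * cis ((\<theta> - pi) / 2)"
  proof -
    have c: "cos \<theta> = 1 - 2 * (sin (\<theta> / 2))\<^sup>2" using cos_double_sin[of "\<theta> / 2"] by simp
    have s: "sin \<theta> = 2 * sin (\<theta> / 2) * cos (\<theta> / 2)" using sin_double[of "\<theta> / 2"] by simp
    have e: "(\<theta> - pi) / 2 = \<theta> / 2 - pi / 2" by (simp add: field_simps)
    have "cos ((\<theta> - pi) / 2) = sin (\<theta> / 2)" "sin ((\<theta> - pi) / 2) = - cos (\<theta> / 2)"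
      unfolding e by (simp_all add: cos_diff sin_diff)
    then show ?thesis using c s by (simp add: complex_eq_iff power2_eq_square)
  qed
  also have "Ln \<dots> = of_real (ln (2 * sin (\<theta> / 2))) + Ln (cis ((\<theta> - pi) / 2))"
    using pos Ln_times_of_real[of "2 * sin (\<theta> / 2)" "cis ((\<theta> - pi) / 2)"]
      Ln_of_real[of "2 * sin (\<theta> / 2)"] cis_neq_zero by simp
  also have "Ln (cis ((\<theta> - pi) / 2)) = \<i> * of_real ((\<theta> - pi) / 2)"
    unfolding cis_conv_exp using assms by (intro Ln_exp) auto
  finally show ?thesis by simp
qed

text \<open>Imaginary part of the power series of the logarithm: the Abel means of the sawtooth
  series. The index 0 contributes zero.\<close>

lemma Im_Ln_one_minus_rcis_sums:
  assumes "0 \<le> r" "r < 1"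
  shows "(\<lambda>n. r ^ n / real n * sin (real n * \<theta>)) sums (- Im (Ln (1 - rcis r \<theta>)))"
proof -
  have "(\<lambda>n. - ((- (- rcis r \<theta>)) ^ n) / of_nat n) sums ln (1 + (- rcis r \<theta>))"
    using assms by (intro Ln_series') simp
  then have "(\<lambda>n. Im (- ((rcis r \<theta>) ^ n) / of_nat n)) sums Im (ln (1 - rcis r \<theta>))"
    by (intro sums_Im) simp
  from sums_minus[OF this] show ?thesis
    by (simp add: DeMoivre2 Im_divide_of_nat)
qed

text \<open>The argument of the logarithm stays in the right half-plane, off the branch cut, even at
  radius 1 when the angle keeps away from the jump. Uniform continuity on a compact rectangle then
  makes one radius below 1 work for all angles.\<close>

lemma Im_Ln_one_minus_rcis_approx:
  assumes w: "0 < w" and e: "0 < e"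
  obtains r where "0 \<le> r" "r < 1"
   "\<And>\<theta>. w \<le> \<theta> \<Longrightarrow> \<theta> \<le> 2 * pi - w \<Longrightarrow> \<bar>Im (Ln (1 - rcis r \<theta>)) - (\<theta> - pi) / 2\<bar> < e"
proof -
  define I where "I = {w..2 * pi - w}"
  define F where "F = (\<lambda>z :: real \<times> real. Im (Ln (1 - rcis (fst z) (snd z))))"
  have "continuous_on ({0..1} \<times> I) F"
    unfolding F_def rcis_def
  proof (intro continuous_intros)
    fix z :: "real \<times> real" assume z: "z \<in> {0..1} \<times> I"
    have "Re (1 - of_real (fst z) * cis (snd z)) > 0"
    proof -
      have "cos (snd z) < 1"
      proof -
        have "0 < sin (snd z / 2)" using z w by (intro sin_gt_zero) (auto simp: I_def)
        then show ?thesis using cos_double_sin[of "snd z / 2"] by simp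
      qed
      moreover have "fst z * cos (snd z) < 1"
      proof (cases "cos (snd z) \<le> 0")
        case True
        then have "fst z * cos (snd z) \<le> 0" using z by (auto simp: mult_nonneg_nonpos)
        then show ?thesis by linarith
      next
        case False
        then have "fst z * cos (snd z) \<le> 1 * cos (snd z)" using z by (intro mult_right_mono) auto
        then show ?thesis using \<open>cos (snd z) < 1\<close> by simp
      qed
      ultimately show ?thesis by simp
    qed
    then show "1 - of_real (fst z) * cis (snd z) \<notin> \<real>\<^sub>\<le>\<^sub>0"
      by (auto simp: complex_nonpos_Reals_iff)
  qed
  moreover have "compact ({0..1::real} \<times> I)" by (intro compact_Times) (auto simp: I_def)
  ultimately have "uniformly_continuous_on ({0..1} \<times> I) F" by (rule compact_uniformly_continuous)
  then obtain d where d: "d > 0" 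
     "\<And>z z'. z \<in> {0..1} \<times> I \<Longrightarrow> z' \<in> {0..1} \<times> I \<Longrightarrow> dist z' z < d \<Longrightarrow> dist (F z') (F z) < e"
    using e unfolding uniformly_continuous_on_def by blast
  define r where "r = max 0 (1 - d / 2)"
  show ?thesis
  proof
    show "0 \<le> r" "r < 1" using d by (auto simp: r_def)
    fix \<theta> assume \<theta>: "w \<le> \<theta>" "\<theta> \<le> 2 * pi - w"
    have "dist (F (r, \<theta>)) (F (1, \<theta>)) < e"
    proof (rule d(2))
      show "dist (r, \<theta>) (1, \<theta>) < d" using d(1) by (auto simp: dist_Pair_Pair dist_real_def r_def)
    qed (use \<theta> d(1) in \<open>auto simp: I_def r_def\<close>)
    then show "\<bar>Im (Ln (1 - rcis r \<theta>)) - (\<theta> - pi) / 2\<bar> < e"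
      using Im_Ln_one_minus_cis[of \<theta>] \<theta> w by (simp add: F_def dist_real_def rcis_def)
  qed
qed

text \<open>The sine polynomial is a partial sum of the Abel means of the sawtooth series
  \<open>\<Sum> sin (2 \<pi> h x) / (\<pi> h) = 1 / 2 - frac x\<close>. Near the jump the means are only known to be at least
  \<open>- 1 / 2\<close>, which suffices because of the shift by \<open>w\<close>.\<close>

lemma floor_le_sine_polynomial:
  assumes w: "0 < w" "w < 1 / 2"
  obtains H :: nat and b :: "nat \<Rightarrow> real" where
    "\<And>x. of_int \<lfloor>x - w\<rfloor> \<le> x - 1 / 2 + (\<Sum>h=1..H. b h * sin (2 * pi * real h * x)) + 2 * w"
proof -
  \<comment> \<open>With \<theta> = 2 pi x, division by pi turns the error pi w into w; truncating
    the series costs another w.\<close>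
  obtain r where r: "0 \<le> r" "r < 1" and
    approx: "\<And>\<theta>. 2 * pi * w \<le> \<theta> \<Longrightarrow> \<theta> \<le> 2 * pi - 2 * pi * w \<Longrightarrow>
       \<bar>Im (Ln (1 - rcis r \<theta>)) - (\<theta> - pi) / 2\<bar> < pi * w"
    using Im_Ln_one_minus_rcis_approx[of "2 * pi * w" "pi * w"] w by auto
  define S where "S x = - Im (Ln (1 - rcis r (2 * pi * x))) / pi" for x
  define f where "f n x = r ^ n / real n / pi * sin (2 * pi * real n * x)" for n :: nat and x
  have S_sums: "(\<lambda>n. f n x) sums S x" for x
  proof -
    have "(\<lambda>n. r ^ n / real n * sin (real n * (2 * pi * x)) / pi) sums S x"
      unfolding S_def using r by (intro sums_divide Im_Ln_one_minus_rcis_sums)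
    then show ?thesis by (simp add: f_def mult_ac)
  qed
  \<comment> \<open>Domination by a geometric series makes the convergence uniform, so one partial
    sum serves every x.\<close>
  have "uniform_limit UNIV (\<lambda>n x. \<Sum>i<n. f i x) (\<lambda>x. suminf (\<lambda>i. f i x)) sequentially"
  proof (rule Weierstrass_m_test)
    fix n :: nat and x :: real
    show "norm (f n x) \<le> r ^ n"
    proof (cases "n = 0")
      case False
      have "norm (f n x) = r ^ n / (real n * pi) * \<bar>sin (2 * pi * real n * x)\<bar>"
        using r by (simp add: f_def abs_mult)
      also have "\<dots> \<le> r ^ n / (real n * pi) * 1" using r by (intro mult_left_mono) auto
      also have "\<dots> \<le> r ^ n / 1"
      proof -
        have "1 * 1 \<le> real n * pi" using False pi_ge_two by (intro mult_mono) auto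
        then have "r ^ n / (real n * pi) \<le> r ^ n / 1" using r by (intro divide_left_mono) auto
        then show ?thesis by simp
      qed
      finally show ?thesis by simp
    qed (simp add: f_def)
  qed (use r in simp)
  moreover have "(\<lambda>x. suminf (\<lambda>i. f i x)) = S" using S_sums by (auto simp: sums_iff)
  ultimately have "\<forall>\<^sub>F n in sequentially. \<forall>x\<in>UNIV. dist (\<Sum>i<n. f i x) (S x) < w"
    using w unfolding uniform_limit_iff by auto
  then obtain N where N: "\<And>x. \<bar>(\<Sum>i<N. f i x) - S x\<bar> < w" 
    unfolding eventually_sequentially dist_real_def by blast
  define P where "P x = (\<Sum>h=1..N-1. r ^ h / real h / pi * sin (2 * pi * real h * x))" for x
  have P: "\<bar>P x - S x\<bar> < w" for x
  proof -
    have "(\<Sum>i<N. f i x) = P x"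
      unfolding P_def f_def by (rule sum.mono_neutral_cong_right) (auto simp: not_le)
    then show ?thesis using N[of x] by simp
  qed
  \<comment> \<open>Positive real part keeps the argument below pi/2.\<close>
  have S_ge: "- 1 / 2 \<le> S x" for x
  proof -
    have "Re (rcis r (2 * pi * x)) \<le> cmod (rcis r (2 * pi * x))" by (rule complex_Re_le_cmod)
    then have "Re (1 - rcis r (2 * pi * x)) > 0" using r by simp
    then have "Im (Ln (1 - rcis r (2 * pi * x))) < pi / 2" using Re_Ln_pos_lt_imp by fastforce
    then show ?thesis by (simp add: S_def field_simps)
  qed
  have P_period: "P (frac x) = P x" for x
  proof -
    have "sin (2 * pi * real h * frac x) = sin (2 * pi * real h * x)" for h :: nat
    proof -
      have "sin (2 * pi * real h * x) = sin (2 * pi * real h * frac x + 2 * pi * of_int (int h * \<lfloor>x\<rfloor>))"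
        by (simp add: frac_def algebra_simps)
      also have "\<dots> = sin (2 * pi * real h * frac x)"
        using sin_integer_2pi[of "of_int (int h * \<lfloor>x\<rfloor>) :: real"]
          cos_integer_2pi[of "of_int (int h * \<lfloor>x\<rfloor>) :: real"] by (simp add: sin_add)
      finally show ?thesis by simp
    qed
    then show ?thesis by (simp add: P_def)
  qed
  have main: "of_int \<lfloor>x - w\<rfloor> \<le> x - 1 / 2 + P x + 2 * w" for x
  proof -
    define y where "y = frac x"
    have y: "0 \<le> y" "y < 1" by (simp_all add: y_def frac_lt_1)
    have xy: "of_int \<lfloor>x\<rfloor> = x - y" by (simp add: y_def frac_def)
    have Sy: "P x > S y - w" using P[of y] P_period[of x] by (simp add: y_def)
    have mono: "real_of_int \<lfloor>x - w\<rfloor> \<le> x - y" using w xy by (smt (verit) floor_mono of_int_le_iff)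
    \<comment> \<open>Just after a jump the shift by w lowers the floor by one; just before a jump
      the bound -1/2 is within w of the sawtooth; in between the Abel mean approximates it.\<close>
    consider "y < w" | "w \<le> y" "y \<le> 1 - w" | "1 - w < y" by linarith
    then show ?thesis
    proof cases
      case 1
      then have "\<lfloor>x - w\<rfloor> < \<lfloor>x\<rfloor>" using xy by (simp add: floor_less_iff)
      then have "real_of_int \<lfloor>x - w\<rfloor> \<le> x - y - 1" using xy by linarith
      then show ?thesis using S_ge[of y] Sy y w by simp
    next
      case 2
      have "2 * pi * y \<le> 2 * pi * (1 - w)" using 2 by (intro mult_left_mono) auto
      then have "\<bar>Im (Ln (1 - rcis r (2 * pi * y))) - (2 * pi * y - pi) / 2\<bar> < pi * w"
        using 2 by (intro approx) (auto simp: algebra_simps)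
      then have "Im (Ln (1 - rcis r (2 * pi * y))) < (2 * pi * y - pi) / 2 + pi * w" by linarith
      also have "\<dots> = (w + y - 1 / 2) * pi" by (simp add: field_simps)
      finally have "Im (Ln (1 - rcis r (2 * pi * y))) < (w + y - 1 / 2) * pi" .
      then have "Im (Ln (1 - rcis r (2 * pi * y))) / pi < w + y - 1 / 2"
        by (subst pos_divide_less_eq) auto
      then have "S y > 1 / 2 - y - w" by (simp add: S_def)
      then show ?thesis using Sy mono by simp
    next
      case 3
      then show ?thesis using S_ge[of y] Sy mono by simp
    qed
  qed
  show ?thesis by (rule that[where H = "N - 1" and b = "\<lambda>h. r ^ h / real h / pi"]) (use main in \<open>simp add: P_def\<close>)
qed

section \<open>Upper bound: large \<alpha> with few lattice points for every slope\<close>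

lemma simultaneous_near_integers:
  fixes M \<eta> :: real and D :: nat
  assumes "0 < \<eta>"
  obtains \<alpha> where "M \<le> \<alpha>" "\<And>d. d \<le> D \<Longrightarrow> \<exists>n::int. \<bar>\<alpha> * sqrt (real d) - of_int n\<bar> \<le> \<eta>"
proof -
  \<comment> \<open>Applying Dirichlet's theorem to the multiples m \<open>sqrt i\<close> makes the
    final multiplier q m at least M.\<close>
  define m where "m = max 1 \<lceil>M\<rceil>"
  define N where "N = nat \<lceil>1 / \<eta>\<rceil>"
  have N: "0 < N" "1 / \<eta> \<le> real N" using assms by (simp_all add: N_def)
  obtain q p where qp: "0 < q"
    "\<And>i. i < Suc D \<Longrightarrow> \<bar>of_int q * (of_int m * sqrt (real i)) - of_int (p i)\<bar> < 1 / N"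
    using Dirichlet_approx_simult[OF N(1), where n = "Suc D" and \<theta> = "\<lambda>i. of_int m * sqrt (real i)"] by metis
  show ?thesis
  proof
    have "1 * m \<le> q * m" using qp(1) by (intro mult_right_mono) (auto simp: m_def)
    moreover have "M \<le> of_int m" unfolding m_def by linarith
    ultimately show "M \<le> of_int (q * m)" by linarith
    fix d assume "d \<le> D"
    moreover have "1 / N \<le> \<eta>" using N assms by (simp add: field_simps)
    ultimately have "\<bar>of_int (q * m) * sqrt (real d) - of_int (p d)\<bar> \<le> \<eta>"
      using qp(2)[of d] by (simp add: mult.assoc)
    then show "\<exists>n::int. \<bar>of_int (q * m) * sqrt (real d) - of_int n\<bar> \<le> \<eta>" ..
  qed
qed

lemma sum_linear:
  fixes c \<beta> :: real
  shows "(\<Sum>k=1..K. c - real k * \<beta>) = real K * c - \<beta> * real K * (real K + 1) / 2"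
  by (induction K) (simp_all add: field_simps)

lemma lattice_count_le_of_large_slope:
  assumes \<alpha>: "2 \<le> \<alpha>" and \<beta>: "16 \<le> \<beta>"
  shows "real (lattice_count \<beta> \<alpha>) \<le> \<alpha>\<^sup>2 / 2 - \<alpha>"
proof -
  define s where "s = sqrt \<beta>"
  have s: "s > 0" "\<beta> = s * s" using \<beta> by (auto simp: s_def)
  have s4: "4 \<le> s" unfolding s_def using \<beta> by (intro real_le_rsqrt) simp
  define x where "x = \<alpha> / s"
  have xs: "\<alpha> = x * s" and x0: "x > 0" using s \<alpha> by (simp_all add: x_def)
  define K where "K = nat \<lfloor>x\<rfloor>"
  have K: "real K \<le> x" "x < real K + 1" unfolding K_def using x0 by linarith+
  have "real (lattice_count \<beta> \<alpha>) = (\<Sum>k=1..K. real_of_int \<lfloor>\<alpha> * s - real k * \<beta>\<rfloor>)"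
    using lattice_count_eq_sum[of \<alpha> \<beta>] \<alpha> \<beta> by (simp add: K_def x_def s_def)
  also have "\<dots> \<le> (\<Sum>k=1..K. \<alpha> * s - real k * \<beta>)" by (intro sum_mono of_int_floor_le)
  also have "\<dots> = \<alpha>\<^sup>2 / 2 - (s * (x - K))\<^sup>2 / 2 - s * s * K / 2"
    unfolding sum_linear by (simp add: xs s(2) power2_eq_square field_simps)
  finally have le: "real (lattice_count \<beta> \<alpha>) \<le> \<alpha>\<^sup>2 / 2 - (s * (x - K))\<^sup>2 / 2 - s * s * K / 2" .
  show ?thesis
  proof (cases "K = 0")
    case True
    then have "lattice_count \<beta> \<alpha> = 0"
      using lattice_count_eq_sum[of \<alpha> \<beta>] \<alpha> \<beta> by (simp add: K_def x_def s_def)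
    moreover have "2 * \<alpha> \<le> \<alpha> * \<alpha>" using \<alpha> by (intro mult_right_mono) auto
    ultimately show ?thesis by (simp add: power2_eq_square)
  next
    case False
    then have "x \<le> 2 * real K" using K by linarith
    then have "\<alpha> \<le> 2 * real K * s" unfolding xs using s by (intro mult_right_mono) auto
    moreover have "4 * (s * real K) \<le> s * (s * real K)" using s4 s by (intro mult_right_mono) auto
    ultimately have "\<alpha> \<le> s * s * K / 2" by (simp add: mult_ac)
    moreover have "0 \<le> (s * (x - K))\<^sup>2" by simp
    ultimately show ?thesis using le by linarith
  qed
qed

text \<open>Sine sums are needed only for slopes between 1/16 and 16, where K/\<alpha> is bounded;
  steeper slopes have the crude bound and flatter ones are reflected.\<close>

lemma exists_small_lattice_count:
  fixes \<epsilon> M :: real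
  assumes \<epsilon>: "0 < \<epsilon>" "\<epsilon> < 1"
  obtains \<alpha> where "M \<le> \<alpha>" "0 < \<alpha>"
    "\<And>\<beta>. 0 < \<beta> \<Longrightarrow> real (lattice_count \<beta> \<alpha>) \<le> \<alpha>\<^sup>2 / 2 - (1 - \<epsilon>) * \<alpha>"
proof -
  \<comment> \<open>Error shares: \<delta> \<alpha> from squaring \<alpha> + \<delta>, 2 \<delta>
    \<alpha> from the terms in w, and \<epsilon> \<alpha>/8 from the sines, together 3/8 of
    \<epsilon> \<alpha>.\<close>
  define \<delta> where "\<delta> = \<epsilon> / 12"
  \<comment> \<open>As \<open>sqrt \<beta>\<close> is at least 1/4, lowering \<alpha>0 by \<delta>
    lowers every column by at least w.\<close>
  define w where "w = \<delta> / 4"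
  have \<delta>: "0 < \<delta>" "\<delta> < 1 / 12" using \<epsilon> by (simp_all add: \<delta>_def)
  have w: "0 < w" "w < 1 / 2" using \<delta> by (simp_all add: w_def)
  obtain H b where floor_le:
    "\<And>x. of_int \<lfloor>x - w\<rfloor> \<le> x - 1 / 2 + (\<Sum>h=1..H. b h * sin (2 * pi * real h * x)) + 2 * w"
    using floor_le_sine_polynomial[OF w] by metis
  define B where "B = (\<Sum>h=1..H. \<bar>b h\<bar>)"
  have B: "0 \<le> B" by (simp add: B_def sum_nonneg)
  define e where "e = \<epsilon> / (8 * (B + 1))"
  have e: "0 < e" "B * e \<le> \<epsilon> / 8" using \<epsilon> B by (simp_all add: e_def field_simps)
  \<comment> \<open>The final 1 exceeds \<delta>, so the lower limits survive the passage from
    \<alpha>0 to \<alpha>.\<close>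
  define M' where "M' = max (max M 2) (max (16 / \<epsilon>) (100 * (3 / (2 * e) + 32 / e\<^sup>2) / e)) + 1"
  \<comment> \<open>The range of d contains every product h l with h \<le> H and l \<le> 16 h +
    1.\<close>
  obtain \<alpha>0 where \<alpha>0: "M' \<le> \<alpha>0"
    and near: "\<And>d. d \<le> H * (16 * H + 1) \<Longrightarrow> \<exists>n::int. \<bar>\<alpha>0 * sqrt (real d) - of_int n\<bar> \<le> e / 100"
    using simultaneous_near_integers[of "e / 100" M' "H * (16 * H + 1)"] e by auto
  define \<alpha> where "\<alpha> = \<alpha>0 - \<delta>"
  have \<alpha>: "M \<le> \<alpha>" "2 \<le> \<alpha>" "16 / \<epsilon> \<le> \<alpha>" "\<alpha> \<le> \<alpha>0" "2 \<le> \<alpha>0"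
    "100 * (3 / (2 * e) + 32 / e\<^sup>2) / e \<le> \<alpha>0"
    using \<alpha>0 \<delta> unfolding M'_def \<alpha>_def by linarith+
  have mid: "real (lattice_count \<beta> \<alpha>) \<le> \<alpha>\<^sup>2 / 2 - (1 - \<epsilon>) * \<alpha>" if \<beta>: "1 / 16 \<le> \<beta>" "\<beta> \<le> 16" for \<beta>
  proof -
    define s where "s = sqrt \<beta>"
    have s: "s > 0" "\<beta> = s * s" using \<beta> by (auto simp: s_def)
    have s4: "1 / 4 \<le> s"
      unfolding s_def using \<beta> by (intro real_le_rsqrt) (simp add: power2_eq_square)
    define K where "K = nat \<lfloor>\<alpha> / s\<rfloor>"
    have "\<alpha> / s \<ge> 0" using \<alpha> s by simp
    then have K: "real K \<le> \<alpha> / s" "\<alpha> / s - 1 < real K" unfolding K_def by linarith+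
    \<comment> \<open>The number of columns comes from \<alpha> but the phases from \<alpha>0; the
      discrepancy \<delta>/s is at most 1.\<close>
    have "\<delta> / s \<le> \<delta> / (1 / 4)" using \<delta> s4 by (intro divide_left_mono) auto
    then have "\<delta> / s \<le> 1" using \<delta> by simp
    moreover have "0 < \<delta> / s" using \<delta> s by simp
    moreover have "\<alpha> / s = \<alpha>0 / s - \<delta> / s" by (simp add: \<alpha>_def diff_divide_distrib)
    ultimately have K0: "\<bar>real K - \<alpha>0 / s\<bar> \<le> 2" using K by linarith
    define S where "S h = (\<Sum>k=1..K. sin (2 * pi * real h * (\<alpha>0 * s - real k * \<beta>)))" for h :: nat
    have S: "\<bar>S h\<bar> \<le> e * \<alpha>0" if h: "h \<in> {1..H}" for h
      unfolding S_def s_def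
    proof (rule sum_sin_lattice_le[OF e(1) _ \<beta> \<alpha>(5,6)])
      show "1 \<le> h" using h by simp
      show "\<bar>real K - \<alpha>0 / sqrt \<beta>\<bar> \<le> 2" using K0 by (simp add: s_def)
      fix l assume "l \<le> 16 * h + 1"
      then have "h * l \<le> H * (16 * H + 1)" using h by (intro mult_le_mono) auto
      then show "\<exists>n::int. \<bar>\<alpha>0 * sqrt (real (h * l)) - of_int n\<bar> \<le> e / 100" by (rule near)
    qed
    have "real (lattice_count \<beta> \<alpha>) = (\<Sum>k=1..K. real_of_int \<lfloor>\<alpha> * s - real k * \<beta>\<rfloor>)"
      using lattice_count_eq_sum[of \<alpha> \<beta>] \<alpha> \<beta> by (simp add: K_def s_def)
    also have "\<dots> \<le> (\<Sum>k=1..K. (\<alpha>0 * s - real k * \<beta>) +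
        (\<Sum>h=1..H. b h * sin (2 * pi * real h * (\<alpha>0 * s - real k * \<beta>))) + (2 * w - 1 / 2))"
    proof (rule sum_mono)
      fix k
      have "\<delta> * (1 / 4) \<le> \<delta> * s" using \<delta> s4 by (intro mult_left_mono) auto
      then have "\<alpha> * s - real k * \<beta> \<le> (\<alpha>0 * s - real k * \<beta>) - w"
        by (simp add: \<alpha>_def w_def left_diff_distrib)
      then have "real_of_int \<lfloor>\<alpha> * s - real k * \<beta>\<rfloor> \<le> of_int \<lfloor>(\<alpha>0 * s - real k * \<beta>) - w\<rfloor>"
        by (intro of_int_le_iff[THEN iffD2] floor_mono)
      then show "real_of_int \<lfloor>\<alpha> * s - real k * \<beta>\<rfloor> \<le> (\<alpha>0 * s - real k * \<beta>) +
        (\<Sum>h=1..H. b h * sin (2 * pi * real h * (\<alpha>0 * s - real k * \<beta>))) + (2 * w - 1 / 2)"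
        using floor_le[of "\<alpha>0 * s - real k * \<beta>"] by linarith
    qed
    also have "\<dots> = (real K * (\<alpha>0 * s) - \<beta> * real K * (real K + 1) / 2) + (\<Sum>h=1..H. b h * S h)
       + real K * (2 * w - 1 / 2)"
      unfolding sum.distrib sum_linear
      by (subst sum.swap) (simp add: S_def sum_distrib_left)
    also have "\<dots> \<le> \<alpha>0\<^sup>2 / 2 - (\<alpha> - 17 / 2) + \<epsilon> / 8 * \<alpha>0 + 2 * \<delta> * \<alpha>"
    proof -
      \<comment> \<open>Completing the square in s K.\<close>
      have "0 \<le> (\<alpha>0 - s * real K)\<^sup>2" by simp
      then have 1: "real K * (\<alpha>0 * s) - \<beta> * real K * (real K + 1) / 2 \<le> \<alpha>0\<^sup>2 / 2 - \<beta> / 2 * real K"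
        by (simp add: s(2) power2_eq_square field_simps)
      have "\<bar>\<Sum>h=1..H. b h * S h\<bar> \<le> (\<Sum>h=1..H. \<bar>b h\<bar> * (e * \<alpha>0))"
        using S by (intro sum_abs[THEN order_trans] sum_mono) (auto simp: abs_mult intro!: mult_left_mono)
      also have "\<dots> = B * e * \<alpha>0" by (simp add: B_def sum_distrib_right mult.assoc)
      also have "\<dots> \<le> \<epsilon> / 8 * \<alpha>0" using e \<alpha> by (intro mult_right_mono) auto
      finally have 2: "(\<Sum>h=1..H. b h * S h) \<le> \<epsilon> / 8 * \<alpha>0" by linarith
      have "\<alpha> / s \<le> \<alpha> / (1 / 4)" using \<alpha> s4 by (intro divide_left_mono) auto
      then have "real K \<le> 4 * \<alpha>" using K by simp
      then have 3: "real K * (2 * w) \<le> 4 * \<alpha> * (2 * w)" using w by (intro mult_right_mono) auto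
      \<comment> \<open>c collects the loss per column: \<beta>/2 from the linear sum and 1/2 from
        the floors. Then c \<alpha>/s is \<alpha> times the mean of s and 1/s, hence at least
        \<alpha>.\<close>
      define c where "c = (\<beta> + 1) / 2"
      have c: "0 \<le> c" "c \<le> 17 / 2" using \<beta> by (simp_all add: c_def)
      have "c * (\<alpha> / s - 1) \<le> c * real K"
        using K c by (intro mult_left_mono) auto
      moreover have "\<alpha> \<le> c * (\<alpha> / s)"
      proof -
        have "0 \<le> (s - 1)\<^sup>2" by simp
        then have "2 * s \<le> \<beta> + 1" by (simp add: s(2) power2_eq_square algebra_simps)
        then have "\<alpha> * (2 * s) \<le> \<alpha> * (\<beta> + 1)" using \<alpha> by (intro mult_left_mono) auto
        then show ?thesis using s(1) by (simp add: c_def pos_le_divide_eq mult_ac)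
      qed
      moreover have "c * (\<alpha> / s - 1) = c * (\<alpha> / s) - c"
        by (simp add: right_diff_distrib)
      ultimately have "\<alpha> - 17 / 2 \<le> c * real K" using c by linarith
      then have 4: "\<alpha> - 17 / 2 \<le> \<beta> / 2 * real K + real K / 2" by (simp add: c_def field_simps)
      have 5: "real K * (2 * w - 1 / 2) = real K * (2 * w) - real K / 2" by (simp add: right_diff_distrib)
      have 6: "4 * \<alpha> * (2 * w) = 2 * \<delta> * \<alpha>" by (simp add: w_def)
      show ?thesis using 1 2 3 4 unfolding 5 6 by linarith
    qed
    also have "\<dots> = \<alpha>\<^sup>2 / 2 - \<alpha> + 3 / 8 * \<epsilon> * \<alpha> + (17 / 2 + \<delta>\<^sup>2 / 2 + \<epsilon> / 8 * \<delta>)"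
    proof -
      have subst: "\<alpha>0 = \<alpha> + \<delta>" "\<epsilon> = 12 * \<delta>" by (simp_all add: \<alpha>_def \<delta>_def)
      show ?thesis unfolding subst by (simp add: power2_eq_square algebra_simps add_divide_distrib)
    qed
    also have "\<dots> \<le> \<alpha>\<^sup>2 / 2 - \<alpha> + 3 / 8 * \<epsilon> * \<alpha> + 10"
    proof -
      have "\<delta> * \<delta> \<le> 1 * 1" using \<delta> by (intro mult_mono) auto
      moreover have "\<epsilon> * \<delta> \<le> 1 * 1" using \<delta> \<epsilon> by (intro mult_mono) auto
      ultimately show ?thesis by (simp add: power2_eq_square)
    qed
    also have "\<dots> \<le> \<alpha>\<^sup>2 / 2 - (1 - \<epsilon>) * \<alpha>"
    proof -
      have "16 \<le> \<alpha> * \<epsilon>" using \<alpha>(3) \<epsilon>(1) by (subst (asm) pos_divide_le_eq)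
      then show ?thesis by (simp add: algebra_simps)
    qed
    finally show ?thesis .
  qed
  have large: "real (lattice_count \<beta> \<alpha>) \<le> \<alpha>\<^sup>2 / 2 - (1 - \<epsilon>) * \<alpha>" if "16 \<le> \<beta>" for \<beta>
  proof -
    have "0 \<le> \<epsilon> * \<alpha>" using \<epsilon> \<alpha> by simp
    then show ?thesis
      using lattice_count_le_of_large_slope[OF \<alpha>(2) that] by (simp add: left_diff_distrib)
  qed
  show ?thesis
  proof
    fix \<beta> :: real assume \<beta>: "0 < \<beta>"
    consider "1 / 16 \<le> \<beta>" "\<beta> \<le> 16" | "16 \<le> \<beta>" | "\<beta> < 1 / 16" by linarith
    then show "real (lattice_count \<beta> \<alpha>) \<le> \<alpha>\<^sup>2 / 2 - (1 - \<epsilon>) * \<alpha>"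
    proof cases
      case 3
      then have "16 \<le> 1 / \<beta>" using \<beta> by (simp add: field_simps)
      then show ?thesis using large[of "1 / \<beta>"] lattice_count_inverse[OF \<beta>] by simp
    qed (use mid large in auto)
  qed (use \<alpha> in auto)
qed

section \<open>Lower bound: slopes 1 + 1/q\<close>

text \<open>The residues \<open>r\<close> of \<open>n - k\<close> decrease by \<open>1\<close> cyclically, and \<open>r (q - r) / 2\<close> is a discrete antiderivative of
  their deviation from the mean \<open>(q - 1) / 2\<close>.\<close>

lemma sum_mod_eq:
  fixes n q :: int
  assumes q: "0 < q"
  shows "2 * (\<Sum>k=1..K. (n - int k) mod q) =
    int K * (q - 1) + (n - int K) mod q * (q - (n - int K) mod q) - n mod q * (q - n mod q)"
proof (induction K)
  case (Suc K)
  define r where "r = (n - int K) mod q"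
  have r: "0 \<le> r" "r < q" using q by (simp_all add: r_def)
  have e: "(n - int (Suc K)) mod q = (r - 1) mod q"
    unfolding r_def by (simp add: mod_simps algebra_simps)
  have "(r - 1) mod q = (if r = 0 then q - 1 else r - 1)"
    using r q by (auto simp: zmod_minus1 mod_pos_pos_trivial)
  then have "2 * ((r - 1) mod q) = q - 1 + (r - 1) mod q * (q - (r - 1) mod q) - r * (q - r)"
    by (auto simp: algebra_simps)
  moreover have "(\<Sum>k=1..Suc K. (n - int k) mod q) = (\<Sum>k=1..K. (n - int k) mod q) + (r - 1) mod q"
    by (simp add: e del: of_nat_Suc)
  ultimately show ?case using Suc unfolding r_def[symmetric] e by (simp add: algebra_simps)
qed simp

text \<open>Since q + 1 is 1 modulo q, the columns run cyclically through the residues modulo q.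
  Their rounding losses therefore average (q - 1)/(2 q), up to a bounded total error.\<close>

lemma lattice_count_ge:
  fixes q :: nat
  assumes q: "1 \<le> q" and \<alpha>: "0 < \<alpha>" and \<beta>: "\<beta> = (real q + 1) / real q"
  shows "\<alpha>\<^sup>2 / 2 - \<alpha> * sqrt \<beta> - (1 + real q / 2) \<le> real (lattice_count \<beta> \<alpha>)"
proof -
  have \<beta>12: "0 < \<beta>" "\<beta> \<le> 2" using q by (simp_all add: \<beta> field_simps)
  define s where "s = sqrt \<beta>"
  have s: "s > 0" "\<beta> = s * s" using \<beta>12 by (auto simp: s_def)
  define x where "x = \<alpha> / s"
  have xs: "\<alpha> = x * s" and x0: "x > 0" using s \<alpha> by (simp_all add: x_def)
  define K where "K = nat \<lfloor>x\<rfloor>"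
  have K: "real K \<le> x" "x < real K + 1" unfolding K_def using x0 by linarith+
  define n where "n = \<lfloor>real q * (\<alpha> * s)\<rfloor>"
  define R where "R = (\<Sum>k=1..K. (n - int k) mod int q)"
  \<comment> \<open>Because q \<beta> is an integer, q \<alpha> s may be replaced by its floor n
    without changing any column.\<close>
  have floor_eq: "real_of_int \<lfloor>\<alpha> * s - real k * \<beta>\<rfloor> =
     (of_int n / real q - real k * \<beta>) - of_int ((n - int k) mod int q) / real q" for k :: nat
  proof -
    have "\<alpha> * s - real k * \<beta> = (real q * (\<alpha> * s) - of_int (int (k * (q + 1)))) / of_int (int q)"
      using q by (simp add: \<beta> field_simps)
    then have "\<lfloor>\<alpha> * s - real k * \<beta>\<rfloor> = \<lfloor>real q * (\<alpha> * s) - of_int (int (k * (q + 1)))\<rfloor> div int q"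
      using floor_divide_real_eq_div[of "int q" "real q * (\<alpha> * s) - of_int (int (k * (q + 1)))"] by simp
    also have "\<lfloor>real q * (\<alpha> * s) - of_int (int (k * (q + 1)))\<rfloor> = n - int (k * (q + 1))"
      unfolding n_def by (rule floor_diff_of_int)
    finally have f: "\<lfloor>\<alpha> * s - real k * \<beta>\<rfloor> = (n - int (k * (q + 1))) div int q" .
    have m: "(n - int (k * (q + 1))) mod int q = (n - int k) mod int q"
    proof -
      have "n - int (k * (q + 1)) = n - int k + int q * (- int k)" by (simp add: algebra_simps)
      then show ?thesis by (simp only: mod_mult_self2)
    qed
    have "(n - int (k * (q + 1))) div int q * int q = n - int (k * (q + 1)) - (n - int k) mod int q"
      using div_mult_mod_eq[of "n - int (k * (q + 1))" "int q"] m by linarith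
    then have "real_of_int (\<lfloor>\<alpha> * s - real k * \<beta>\<rfloor> * int q)
      = real_of_int (n - int (k * (q + 1)) - (n - int k) mod int q)" unfolding f by (rule arg_cong)
    then have "real_of_int \<lfloor>\<alpha> * s - real k * \<beta>\<rfloor> * real q
      = of_int n - real k * (real q + 1) - of_int ((n - int k) mod int q)"
      by (simp add: distrib_left)
    then have "real_of_int \<lfloor>\<alpha> * s - real k * \<beta>\<rfloor>
      = (of_int n - real k * (real q + 1) - of_int ((n - int k) mod int q)) / real q"
      using q by (subst eq_divide_eq) auto
    then show ?thesis unfolding \<beta> by (simp add: diff_divide_distrib del: of_nat_add of_nat_Suc)
  qed
  have R: "2 * real_of_int R \<le> real K * (real q - 1) + (real q)\<^sup>2"
  proof -
    have r: "0 \<le> n mod int q" "n mod int q < int q" "0 \<le> (n - int K) mod int q" "(n - int K) mod int q < int q"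
      using q by simp_all
    have 1: "(n - int K) mod int q * (int q - (n - int K) mod int q) \<le> int q * int q"
      by (intro mult_mono) (use r in linarith)+
    have 2: "0 \<le> n mod int q * (int q - n mod int q)"
      by (intro mult_nonneg_nonneg) (use r in linarith)+
    have "a + b - c \<le> a + d" if "b \<le> d" "0 \<le> c" for a b c d :: int
      using that by linarith
    from this[OF 1 2] have "2 * R \<le> int K * (int q - 1) + int q * int q"
      unfolding R_def using q by (subst sum_mod_eq) auto
    then have "real_of_int (2 * R) \<le> real_of_int (int K * (int q - 1) + int q * int q)"
      by (simp only: of_int_le_iff)
    then show ?thesis by (simp add: power2_eq_square)
  qed
  have "real (lattice_count \<beta> \<alpha>) = (\<Sum>k=1..K. real_of_int \<lfloor>\<alpha> * s - real k * \<beta>\<rfloor>)"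
    using lattice_count_eq_sum[of \<alpha> \<beta>] \<alpha> \<beta>12 by (simp add: K_def x_def s_def)
  also have "\<dots> = real K * (of_int n / real q) - \<beta> * real K * (real K + 1) / 2 - of_int R / real q"
    unfolding floor_eq sum_subtractf[of "\<lambda>k. of_int n / real q - real k * \<beta>"] sum_linear
    by (simp add: R_def sum_divide_distrib)
  finally have eq: "real (lattice_count \<beta> \<alpha>) = \<dots>" .
  have "real q * (\<alpha> * s) - 1 \<le> of_int n" unfolding n_def by linarith
  then have "(real q * (\<alpha> * s) - 1) / real q \<le> of_int n / real q" by (rule divide_right_mono) simp
  then have "\<alpha> * s - 1 / real q \<le> of_int n / real q" using q by (simp add: diff_divide_distrib)
  then have 1: "real K * (\<alpha> * s - 1 / real q) \<le> real K * (of_int n / real q)" by (rule mult_left_mono) simp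
  have "2 * real_of_int R / (2 * real q) \<le> (real K * (real q - 1) + (real q)\<^sup>2) / (2 * real q)"
    using R by (rule divide_right_mono) simp
  then have 2: "of_int R / real q \<le> real K * ((real q - 1) / (2 * real q)) + real q / 2"
    using q by (simp add: add_divide_distrib power2_eq_square)
  have 3: "real K * (\<alpha> * s) - \<beta> * real K * (real K + 1) / 2 = \<alpha>\<^sup>2 / 2 - \<beta> * (x - K)\<^sup>2 / 2 - \<beta> / 2 * real K"
    by (simp add: xs s(2) power2_eq_square field_simps)
  have "(x - K)\<^sup>2 \<le> 1\<^sup>2" using K by (intro power_mono) auto
  then have "\<beta> * (x - K)\<^sup>2 \<le> 2 * 1" using \<beta>12 by (intro mult_mono) auto
  moreover have "real K * \<beta> \<le> \<alpha> * s" using K s by (simp add: xs s(2) mult.assoc[symmetric] mult_right_mono)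
  \<comment> \<open>The losses from rounding to n, from the linear sum and from the residues add up
    to \<beta> per column.\<close>
  moreover have "real K * (1 / real q) + \<beta> / 2 * real K + real K * ((real q - 1) / (2 * real q)) = real K * \<beta>"
    using q by (simp add: \<beta> field_simps)
  ultimately show ?thesis
    using 1 2 3 unfolding eq s_def[symmetric] right_diff_distrib by linarith
qed

section \<open>The lower limit\<close>

theorem theorem3:
  "Liminf at_top (\<lambda>\<alpha>::real. SUP \<beta>\<in>{0<..}.
      ereal ((real (lattice_count \<beta> \<alpha>) - \<alpha>\<^sup>2 / 2) / \<alpha>)) = -1"
proof -
  define F where "F = (\<lambda>\<alpha>::real. SUP \<beta>\<in>{0<..}. ereal ((real (lattice_count \<beta> \<alpha>) - \<alpha>\<^sup>2 / 2) / \<alpha>))"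
  have upper: "Liminf at_top F \<le> ereal (- 1 + \<epsilon>)" if \<epsilon>: "0 < \<epsilon>" "\<epsilon> < 1" for \<epsilon> :: real
  proof (rule ccontr)
    assume "\<not> ?thesis"
    \<comment> \<open>A larger lower limit would force the supremum above the bound for all large
      \<alpha>, against the \<alpha> beyond A found above.\<close>
    then have "\<forall>\<^sub>F \<alpha> in at_top. ereal (- 1 + \<epsilon>) < F \<alpha>" by (intro less_LiminfD) simp
    then obtain A where A: "\<And>\<alpha>. A \<le> \<alpha> \<Longrightarrow> ereal (- 1 + \<epsilon>) < F \<alpha>"
      unfolding eventually_at_top_linorder by blast
    obtain \<alpha> where \<alpha>: "A \<le> \<alpha>" "0 < \<alpha>"
      "\<And>\<beta>. 0 < \<beta> \<Longrightarrow> real (lattice_count \<beta> \<alpha>) \<le> \<alpha>\<^sup>2 / 2 - (1 - \<epsilon>) * \<alpha>"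
      using exists_small_lattice_count[OF \<epsilon>] by metis
    have "F \<alpha> \<le> ereal (- 1 + \<epsilon>)"
      unfolding F_def
    proof (rule SUP_least)
      fix \<beta> :: real assume "\<beta> \<in> {0<..}"
      then have "real (lattice_count \<beta> \<alpha>) - \<alpha>\<^sup>2 / 2 \<le> (- 1 + \<epsilon>) * \<alpha>" using \<alpha>(3)[of \<beta>] by (simp add: algebra_simps)
      then show "ereal ((real (lattice_count \<beta> \<alpha>) - \<alpha>\<^sup>2 / 2) / \<alpha>) \<le> ereal (- 1 + \<epsilon>)"
        using \<alpha>(2) by (simp add: pos_divide_le_eq)
    qed
    then show False using A[OF \<alpha>(1)] by simp
  qed
  have "Liminf at_top F \<le> - 1"
  proof (rule ereal_le_epsilon2)
    fix e :: real assume "0 < e"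
    then have "Liminf at_top F \<le> ereal (- 1 + min e (1 / 2))" by (intro upper) auto
    also have "\<dots> \<le> - 1 + ereal e" by (simp add: one_ereal_def)
    finally show "Liminf at_top F \<le> - 1 + ereal e" .
  qed
  moreover have "- 1 \<le> Liminf at_top F"
  proof (rule ereal_le_epsilon2)
    fix e :: real assume e: "0 < e"
    \<comment> \<open>1/q < e/2 bounds \<open>sqrt \<beta>\<close> by 1 + e/2; the other e/2 absorbs
      C/\<alpha>.\<close>
    obtain q :: nat where q: "2 / e < real q" using reals_Archimedean2 by blast
    have "0 < 2 / e" using e by simp
    then have q1: "1 \<le> q" using q by (cases q) auto
    define \<beta> where "\<beta> = (real q + 1) / real q"
    have "1 \<le> \<beta>" using q1 by (simp add: \<beta>_def)
    then have "sqrt \<beta> * 1 \<le> sqrt \<beta> * sqrt \<beta>" by (intro mult_left_mono) auto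
    then have "sqrt \<beta> \<le> \<beta>" using \<open>1 \<le> \<beta>\<close> by simp
    moreover have "\<beta> \<le> 1 + e / 2" using q q1 e by (simp add: \<beta>_def field_simps)
    ultimately have sq: "sqrt \<beta> \<le> 1 + e / 2" by linarith
    define C where "C = 1 + real q / 2"
    have "\<forall>\<^sub>F \<alpha> in at_top. ereal (- 1 - e) \<le> F \<alpha>"
      using eventually_ge_at_top[of "max 1 (2 * C / e)"]
    proof eventually_elim
      case (elim \<alpha>)
      then have \<alpha>: "0 < \<alpha>" "2 * C / e \<le> \<alpha>" by auto
      then have "2 * C \<le> \<alpha> * e" using e by (simp add: pos_divide_le_eq)
      moreover have "\<alpha> * sqrt \<beta> \<le> \<alpha> * (1 + e / 2)" using sq \<alpha> by (intro mult_left_mono) auto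
      moreover have "\<alpha>\<^sup>2 / 2 - \<alpha> * sqrt \<beta> - C \<le> real (lattice_count \<beta> \<alpha>)"
        unfolding C_def by (rule lattice_count_ge[OF q1 \<alpha>(1) \<beta>_def])
      ultimately have "(- 1 - e) * \<alpha> \<le> real (lattice_count \<beta> \<alpha>) - \<alpha>\<^sup>2 / 2"
        by (simp add: algebra_simps)
      then have "ereal (- 1 - e) \<le> ereal ((real (lattice_count \<beta> \<alpha>) - \<alpha>\<^sup>2 / 2) / \<alpha>)"
        using \<alpha>(1) by (simp add: pos_le_divide_eq)
      also have "\<dots> \<le> F \<alpha>" unfolding F_def using \<open>1 \<le> \<beta>\<close> by (intro SUP_upper) simp
      finally show ?case .
    qed
    then have "ereal (- 1 - e) \<le> Liminf at_top F" by (rule Liminf_bounded)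
    then have "ereal (- 1 - e) + ereal e \<le> Liminf at_top F + ereal e" by (rule add_right_mono)
    then show "- 1 \<le> Liminf at_top F + ereal e" by (simp add: one_ereal_def)
  qed
  ultimately show ?thesis unfolding F_def by (rule antisym)
qed

end
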